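(* For every even positive integer $k$, $$\sqrt[9]{36} \le \zeta_k^{k}.$$ Furthermore, $\lim_{k\to\infty} \zeta_k^{k}$ exists and is at least $\sqrt[9]{36}$.
   Context: All graphs are finite and simple. For a graph $G$ and a vertex $v$, $N(v)$ denotes the set of neighbours of $v$. A set $I\subseteq V(G)$ is independent if it spans no edge. For a positive integer $k$, a $k$-dominating independent set ($k$-DIS) of $G$ is an independent set $D$ such that every vertex $v\in V(G)\setminus D$ satisfies $|N(v)\cap D|\ge k$. Let $mi_k(n)$ denote the maximum number of $k$-DISes in a graph on $n$ vertices. It is known (Nagy) that for every $k\ge 1$ the limit $\zeta_k:=\lim_{n\to\infty}\sqrt[n]{mi_k(n)}$ exists. *)

theory Defs
  imports "HOL-Analysis.Analysis" "Graph_Theory.Graph_Theory"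
begin

text \<open>
  Finite simple graphs are the \<^locale>\<open>pair_graph\<close>s of the entry Graph Theory: finite, loop-free
  and symmetric, without parallel arcs since the arcs form a set of pairs. An undirected edge
  between u and v is represented by the two arcs (u, v) and (v, u).
\<close>

definition neighbours :: "'a pair_pre_digraph \<Rightarrow> 'a \<Rightarrow> 'a set" where
  "neighbours G v = {w. (v, w) \<in> parcs G}"

definition independent_set :: "'a pair_pre_digraph \<Rightarrow> 'a set \<Rightarrow> bool" where
  "independent_set G I \<longleftrightarrow> I \<subseteq> pverts G \<and> (\<forall>u\<in>I. \<forall>v\<in>I. (u, v) \<notin> parcs G)"

definition k_DIS :: "nat \<Rightarrow> 'a pair_pre_digraph \<Rightarrow> 'a set \<Rightarrow> bool" where
  "k_DIS k G D \<longleftrightarrow> independent_set G D \<and>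
     (\<forall>v \<in> pverts G - D. k \<le> card (neighbours G v \<inter> D))"

text \<open>
  Every graph on n vertices is isomorphic to one whose vertices are natural numbers, so it is no
  restriction to let G range over those. The counts are bounded by \<open>2 ^ n\<close>, so that the maximum is
  taken over a finite nonempty set.
\<close>

definition mi :: "nat \<Rightarrow> nat \<Rightarrow> nat" where
  "mi k n = Max {card {D. k_DIS k G D} | G :: nat pair_pre_digraph.
                   pair_graph G \<and> card (pverts G) = n}"

text \<open>
  For \<open>k \<ge> 1\<close> the limit exists: \<open>mi k\<close> is positive and, by disjoint unions, supermultiplicative,
  and it is at most \<open>2 ^ n\<close>, so that Fekete's lemma applies.
\<close>

definition zeta :: "nat \<Rightarrow> real" where
  "zeta k = lim (\<lambda>n. root n (real (mi k n)))"

end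

theory Submission
  imports Defs "HOL-Combinatorics.Permutations" "HOL-Real_Asymp.Real_Asymp"
begin

text \<open>
  Replacing each vertex by m independent copies turns k-DISes into km-DISes, so that
  \<open>zeta k \<le> zeta (k * m) ^ m\<close>. Since \<open>zeta\<close> is decreasing, comparing K with the next multiple of k
  shows that \<open>g k = k * ln (zeta k)\<close> satisfies \<open>K / (K + k) * g k \<le> g K\<close>. As g is bounded by 1,
  it converges to its supremum. The permutations are 2-DISes of the \<open>q \<times> q\<close> rook graph, which for
  \<open>q = 3\<close> gives \<open>zeta 2 \<ge> root 9 6\<close>, and the blow-up inequality transfers this to all even k.
\<close>

section \<open>Graph constructions\<close>

lemma pair_graph_iff:
  "pair_graph G \<longleftrightarrow> finite (pverts G) \<and> parcs G \<subseteq> pverts G \<times> pverts G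
     \<and> (\<forall>v. (v, v) \<notin> parcs G) \<and> sym (parcs G)"  (is "_ \<longleftrightarrow> ?R")
proof
  assume "pair_graph G"
  then interpret pair_graph G .
  show ?R
    using pair_finite_verts pair_sym_arcs no_loops'
    by (auto simp: symmetric_def dest: in_arcsD1 in_arcsD2)
next
  assume R: ?R
  then have "finite (parcs G)"
    by (meson finite_SigmaI finite_subset)
  with R show "pair_graph G"
    by unfold_locales (auto simp: symmetric_def)
qed

lemma finite_k_DIS:
  assumes "finite (pverts G)"
  shows "finite {D. k_DIS k G D}"
  using assms by (rule finite_subset[rotated, OF finite_Pow_iff[THEN iffD2]])
    (auto simp: k_DIS_def independent_set_def)

lemma card_k_DIS_le_two_power:
  assumes "finite (pverts G)"
  shows "card {D. k_DIS k G D} \<le> 2 ^ card (pverts G)"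
proof -
  have "card {D. k_DIS k G D} \<le> card (Pow (pverts G))"
    using assms by (intro card_mono) (auto simp: k_DIS_def independent_set_def)
  then show ?thesis
    using assms by (simp add: card_Pow)
qed

section \<open>Transport along injective vertex maps\<close>

definition relabel :: "('a \<Rightarrow> 'b) \<Rightarrow> 'a pair_pre_digraph \<Rightarrow> 'b pair_pre_digraph" where
  "relabel f G = \<lparr>pverts = f ` pverts G, parcs = {(f u, f v) |u v. (u, v) \<in> parcs G}\<rparr>"

lemma pair_graph_relabel:
  assumes "pair_graph G" "inj_on f (pverts G)"
  shows "pair_graph (relabel f G)"
proof -
  have arcs: "parcs G \<subseteq> pverts G \<times> pverts G"
    using assms by (simp add: pair_graph_iff)
  have "(x, x) \<notin> parcs (relabel f G)" for x
  proof
    assume "(x, x) \<in> parcs (relabel f G)"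
    then obtain u v where "(u, v) \<in> parcs G" "f u = f v"
      by (auto simp: relabel_def)
    with arcs assms show False
      by (auto simp: pair_graph_iff dest: inj_onD)
  qed
  moreover have "sym (parcs (relabel f G))"
    using assms(1) by (simp add: relabel_def pair_graph_iff sym_def) blast
  moreover have "parcs (relabel f G) \<subseteq> pverts (relabel f G) \<times> pverts (relabel f G)"
    using arcs by (auto simp: relabel_def)
  ultimately show ?thesis
    using assms(1) by (auto simp: pair_graph_iff relabel_def)
qed

lemma neighbours_relabel:
  assumes "pair_graph G" "inj_on f (pverts G)" "v \<in> pverts G"
  shows "neighbours (relabel f G) (f v) = f ` neighbours G v"
proof
  have arcs: "parcs G \<subseteq> pverts G \<times> pverts G"
    using assms by (simp add: pair_graph_iff)
  show "neighbours (relabel f G) (f v) \<subseteq> f ` neighbours G v"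
  proof
    fix y assume "y \<in> neighbours (relabel f G) (f v)"
    then obtain u w where "(u, w) \<in> parcs G" "f v = f u" "y = f w"
      by (auto simp: neighbours_def relabel_def)
    moreover from this have "v = u"
      using arcs assms by (auto dest: inj_onD)
    ultimately show "y \<in> f ` neighbours G v"
      by (simp add: neighbours_def)
  qed
qed (auto simp: neighbours_def relabel_def)

lemma k_DIS_relabel:
  assumes G: "pair_graph G" and f: "inj_on f (pverts G)" and D: "k_DIS k G D"
  shows "k_DIS k (relabel f G) (f ` D)"
proof -
  have sub: "D \<subseteq> pverts G" and indep: "\<forall>u\<in>D. \<forall>v\<in>D. (u, v) \<notin> parcs G"
    and dom: "\<forall>v\<in>pverts G - D. k \<le> card (neighbours G v \<inter> D)"
    using D by (auto simp: k_DIS_def independent_set_def)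
  have arcs: "parcs G \<subseteq> pverts G \<times> pverts G"
    using G by (simp add: pair_graph_iff)
  have "(f u, f v) \<notin> parcs (relabel f G)" if "u \<in> D" "v \<in> D" for u v
  proof
    assume "(f u, f v) \<in> parcs (relabel f G)"
    then obtain x y where "(x, y) \<in> parcs G" "f u = f x" "f v = f y"
      by (auto simp: relabel_def)
    with that sub arcs f have "u = x" "v = y"
      by (auto simp: inj_on_def)
    with \<open>(x, y) \<in> parcs G\<close> indep that show False by blast
  qed
  moreover have "k \<le> card (neighbours (relabel f G) (f v) \<inter> f ` D)"
    if "v \<in> pverts G" "f v \<notin> f ` D" for v
  proof -
    have "v \<notin> D" using that(2) by auto
    have N: "neighbours G v \<subseteq> pverts G"
      using arcs by (auto simp: neighbours_def)
    have "neighbours (relabel f G) (f v) \<inter> f ` D = f ` (neighbours G v \<inter> D)"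
      using neighbours_relabel[OF G f that(1)] N sub f by (simp add: inj_on_image_Int)
    moreover have "card (f ` (neighbours G v \<inter> D)) = card (neighbours G v \<inter> D)"
      using f N by (intro card_image) (auto simp: inj_on_def)
    ultimately show ?thesis using dom that(1) \<open>v \<notin> D\<close> by simp
  qed
  moreover have "pverts (relabel f G) = f ` pverts G"
    by (simp add: relabel_def)
  ultimately show ?thesis
    using sub by (auto simp: k_DIS_def independent_set_def)
qed

text \<open>Taking images under \<open>f\<close> is injective on sets of vertices, so no k-DIS is
  lost. This carries counts from vertices of sum or pair type over to the natural numbers, over
  which \<open>mi\<close> ranges.\<close>

lemma card_k_DIS_relabel:
  assumes G: "pair_graph G" and f: "inj_on f (pverts G)"
  shows "card {D. k_DIS k G D} \<le> card {D. k_DIS k (relabel f G) D}"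
proof (rule card_inj_on_le)
  show "inj_on ((`) f) {D. k_DIS k G D}"
    by (rule inj_on_subset[OF inj_on_image_Pow[OF f]])
      (auto simp: k_DIS_def independent_set_def)
  show "(`) f ` {D. k_DIS k G D} \<subseteq> {D. k_DIS k (relabel f G) D}"
    using k_DIS_relabel[OF G f] by auto
  show "finite {D. k_DIS k (relabel f G) D}"
    using pair_graph_relabel[OF G f] by (intro finite_k_DIS) (simp add: pair_graph_iff)
qed

section \<open>Disjoint unions\<close>

definition graph_sum ::
  "'a pair_pre_digraph \<Rightarrow> 'b pair_pre_digraph \<Rightarrow> ('a + 'b) pair_pre_digraph" where
  "graph_sum G H = \<lparr>pverts = pverts G <+> pverts H,
     parcs = {(Inl u, Inl v) |u v. (u, v) \<in> parcs G} \<union> {(Inr u, Inr v) |u v. (u, v) \<in> parcs H}\<rparr>"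

lemma pair_graph_graph_sum:
  assumes "pair_graph G" "pair_graph H"
  shows "pair_graph (graph_sum G H)"
  using assms by (auto simp: pair_graph_iff graph_sum_def sym_def)

lemma neighbours_graph_sum:
  "neighbours (graph_sum G H) (Inl u) = Inl ` neighbours G u"
  "neighbours (graph_sum G H) (Inr v) = Inr ` neighbours H v"
  by (auto simp: neighbours_def graph_sum_def)

text \<open>No arc joins the two sides, so every vertex keeps exactly the dominators it has in its
  own summand.\<close>

lemma k_DIS_graph_sum:
  assumes "k_DIS k G D" "k_DIS k H E"
  shows "k_DIS k (graph_sum G H) (D <+> E)"
proof -
  have "Inl ` A \<inter> (D <+> E) = Inl ` (A \<inter> D)" "Inr ` B \<inter> (D <+> E) = Inr ` (B \<inter> E)" for A B
    by auto
  then have "card (neighbours (graph_sum G H) (Inl u) \<inter> (D <+> E)) = card (neighbours G u \<inter> D)"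
    "card (neighbours (graph_sum G H) (Inr v) \<inter> (D <+> E)) = card (neighbours H v \<inter> E)" for u v
    by (simp_all add: neighbours_graph_sum card_image)
  with assms show ?thesis
    by (auto simp: k_DIS_def independent_set_def graph_sum_def)
qed

lemma card_k_DIS_graph_sum:
  assumes "pair_graph G" "pair_graph H"
  shows "card {D. k_DIS k G D} * card {D. k_DIS k H D} \<le> card {D. k_DIS k (graph_sum G H) D}"
proof -
  let ?f = "\<lambda>(D, E). D <+> E"
  have "card ({D. k_DIS k G D} \<times> {D. k_DIS k H D}) \<le> card {D. k_DIS k (graph_sum G H) D}"
  proof (rule card_inj_on_le)
    show "inj_on ?f ({D. k_DIS k G D} \<times> {D. k_DIS k H D})"
      by (auto simp: inj_on_def Plus_def set_eq_iff)
    show "?f ` ({D. k_DIS k G D} \<times> {D. k_DIS k H D}) \<subseteq> {D. k_DIS k (graph_sum G H) D}"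
      using k_DIS_graph_sum by auto
    show "finite {D. k_DIS k (graph_sum G H) D}"
      using pair_graph_graph_sum[OF assms] by (intro finite_k_DIS) (simp add: pair_graph_iff)
  qed
  then show ?thesis by (simp add: card_cartesian_product)
qed

section \<open>Blow-ups\<close>

text \<open>Adjacency ignores the copy index, so copies of one vertex are nonadjacent when
  \<open>G\<close> has no loops: this is the lexicographic product of \<open>G\<close> with an
  edgeless graph.\<close>

definition blowup :: "nat \<Rightarrow> 'a pair_pre_digraph \<Rightarrow> ('a \<times> nat) pair_pre_digraph" where
  "blowup m G = \<lparr>pverts = pverts G \<times> {..<m},
     parcs = {((u, i), (v, j)). (u, v) \<in> parcs G \<and> i < m \<and> j < m}\<rparr>"

lemma pair_graph_blowup:
  assumes "pair_graph G"
  shows "pair_graph (blowup m G)"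
  using assms by (auto simp: pair_graph_iff blowup_def sym_def)

text \<open>A vertex outside the product is a copy of a vertex outside \<open>D\<close>, and each
  dominator of the latter now counts \<open>m\<close> times.\<close>

lemma k_DIS_blowup:
  assumes "k_DIS k G D"
  shows "k_DIS (k * m) (blowup m G) (D \<times> {..<m})"
proof -
  have "neighbours (blowup m G) (v, j) \<inter> D \<times> {..<m} = (neighbours G v \<inter> D) \<times> {..<m}"
    if "j < m" for v j
    using that by (auto simp: neighbours_def blowup_def)
  with assms show ?thesis
    by (auto simp: k_DIS_def independent_set_def blowup_def card_cartesian_product)
qed

lemma card_k_DIS_blowup:
  assumes "pair_graph G" "0 < m"
  shows "card {D. k_DIS k G D} \<le> card {D. k_DIS (k * m) (blowup m G) D}"
proof (rule card_inj_on_le)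
  \<comment> \<open>For \<open>m = 0\<close> all products would be empty; a nonempty second factor
    makes the first one recoverable.\<close>
  show "inj_on (\<lambda>D. D \<times> {..<m}) {D. k_DIS k G D}"
    using \<open>0 < m\<close> by (auto simp: inj_on_def times_eq_iff)
  show "(\<lambda>D. D \<times> {..<m}) ` {D. k_DIS k G D} \<subseteq> {D. k_DIS (k * m) (blowup m G) D}"
    using k_DIS_blowup by auto
  show "finite {D. k_DIS (k * m) (blowup m G) D}"
    using pair_graph_blowup[OF assms(1), of m] by (intro finite_k_DIS) (simp add: pair_graph_iff)
qed

section \<open>Permutations as 2-DISes of rook graphs\<close>

definition rook_graph :: "nat \<Rightarrow> (nat \<times> nat) pair_pre_digraph" where
  "rook_graph q = \<lparr>pverts = {..<q} \<times> {..<q},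
     parcs = {((a, b), (c, d)). a < q \<and> b < q \<and> c < q \<and> d < q
       \<and> (a = c \<and> b \<noteq> d \<or> a \<noteq> c \<and> b = d)}\<rparr>"

lemma pair_graph_rook_graph: "pair_graph (rook_graph q)"
  by (auto simp: pair_graph_iff rook_graph_def sym_def)

text \<open>A permutation places \<open>q\<close> non-attacking rooks, one in each row and column.
  An empty cell is attacked by the rook in its row and by the one in its column.\<close>

lemma k_DIS_rook_graph:
  assumes p: "p permutes {..<q}"
  shows "k_DIS 2 (rook_graph q) ((\<lambda>i. (i, p i)) ` {..<q})"
proof -
  let ?D = "(\<lambda>i. (i, p i)) ` {..<q}"
  have lt: "p i < q" if "i < q" for i
    using permutes_in_image[OF p, of i] that by simp
  have inj: "p i = p j \<longleftrightarrow> i = j" for i j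
    using permutes_inj[OF p] by (simp add: inj_eq)
  have "2 \<le> card (neighbours (rook_graph q) (a, b) \<inter> ?D)"
    if ab: "a < q" "b < q" "(a, b) \<notin> ?D" for a b
  proof -
    obtain c where c: "c < q" "p c = b"
      using permutes_image[OF p] ab(2) by (metis imageE lessThan_iff)
    \<comment> \<open>Otherwise the cell \<open>(a, b)\<close> would itself carry a rook. Hence the
      two attacking rooks are distinct.\<close>
    have "p a \<noteq> b" "c \<noteq> a"
      using ab c by auto
    then have "card {(a, p a), (c, p c)} = 2" by simp
    moreover have "{(a, p a), (c, p c)} \<subseteq> neighbours (rook_graph q) (a, b) \<inter> ?D"
      using ab c lt \<open>p a \<noteq> b\<close> \<open>c \<noteq> a\<close> by (auto simp: neighbours_def rook_graph_def)
    moreover have "finite ?D" by simp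
    ultimately show ?thesis by (metis card_mono finite_Int)
  qed
  then show ?thesis
    using lt inj by (auto simp: k_DIS_def independent_set_def rook_graph_def)
qed

text \<open>Different permutations give different placements: on the board the placement determines
  the values, and elsewhere every permutation is the identity.\<close>

lemma card_k_DIS_rook_graph: "fact q \<le> card {D. k_DIS 2 (rook_graph q) D}"
proof -
  have "card {p. p permutes {..<q}} \<le> card {D. k_DIS 2 (rook_graph q) D}"
  proof (rule card_inj_on_le)
    show "inj_on (\<lambda>p. (\<lambda>i. (i, p i)) ` {..<q}) {p. p permutes {..<q}}"
    proof (rule inj_onI)
      fix p p' :: "nat \<Rightarrow> nat"
      assume perm: "p \<in> {p. p permutes {..<q}}" "p' \<in> {p. p permutes {..<q}}"
        and eq: "(\<lambda>i. (i, p i)) ` {..<q} = (\<lambda>i. (i, p' i)) ` {..<q}"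
      show "p = p'"
      proof
        fix i
        show "p i = p' i"
        proof (cases "i < q")
          case True
          then have "(i, p i) \<in> (\<lambda>i. (i, p' i)) ` {..<q}"
            using eq by auto
          then show ?thesis by auto
        next
          case False
          then show ?thesis
            using perm by (auto simp: permutes_def)
        qed
      qed
    qed
    show "(\<lambda>p. (\<lambda>i. (i, p i)) ` {..<q}) ` {p. p permutes {..<q}}
        \<subseteq> {D. k_DIS 2 (rook_graph q) D}"
      using k_DIS_rook_graph by auto
    show "finite {D. k_DIS 2 (rook_graph q) D}"
      by (intro finite_k_DIS) (simp add: rook_graph_def)
  qed
  then show ?thesis by (simp add: card_permutations)
qed

section \<open>An exponential upper bound\<close>

definition induced :: "'a pair_pre_digraph \<Rightarrow> 'a set \<Rightarrow> 'a pair_pre_digraph" where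
  "induced G W = \<lparr>pverts = W, parcs = parcs G \<inter> W \<times> W\<rparr>"

lemma pair_graph_induced:
  assumes "pair_graph G" "W \<subseteq> pverts G"
  shows "pair_graph (induced G W)"
  using assms by (auto simp: pair_graph_iff induced_def sym_def finite_subset)

text \<open>By independence, \<open>u\<close> is the only element of \<open>D\<close> that is
  deleted, and the remaining vertices are not adjacent to \<open>u\<close>. So they lose no
  dominator, and \<open>k\<close> stays the same.\<close>

lemma k_DIS_delete_closed_neighbourhood:
  assumes G: "pair_graph G" and D: "k_DIS k G D" and u: "u \<in> D"
  shows "k_DIS k (induced G (pverts G - insert u (neighbours G u))) (D - {u})"
proof -
  let ?W = "pverts G - insert u (neighbours G u)"
  have "k \<le> card (neighbours (induced G ?W) w \<inter> (D - {u}))" if w: "w \<in> ?W - (D - {u})" for w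
  proof -
    have "neighbours G w \<inter> D = neighbours (induced G ?W) w \<inter> (D - {u})"
      using w D u G
      by (auto simp: neighbours_def induced_def k_DIS_def independent_set_def
          pair_graph_iff sym_def)
    moreover have "k \<le> card (neighbours G w \<inter> D)"
      using w D by (auto simp: k_DIS_def)
    ultimately show ?thesis by simp
  qed
  moreover have "D - {u} \<subseteq> ?W" "pverts (induced G ?W) = ?W" "parcs (induced G ?W) \<subseteq> parcs G"
    using D u by (auto simp: neighbours_def k_DIS_def independent_set_def induced_def)
  ultimately show ?thesis
    using D unfolding k_DIS_def independent_set_def by blast
qed

text \<open>
  Induct on the number of vertices, with v of minimum degree d. A k-DIS either contains v or at
  least k of its d neighbours, so that double counting bounds the number of k-DISes by
  \<open>1 + d / k \<le> exp (d / k)\<close> times the largest number of those containing a given vertex.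
\<close>
lemma card_k_DIS_le_exp:
  fixes G :: "'a pair_pre_digraph"
  assumes "pair_graph G" "0 < k"
  shows "real (card {D. k_DIS k G D}) \<le> exp (real (card (pverts G)) / real k)"
  using assms(1)
proof (induction "card (pverts G)" arbitrary: G rule: less_induct)
  case less
  have fin: "finite (pverts G)"
    using less.prems by (simp add: pair_graph_iff)
  show ?case
  proof (cases "pverts G = {}")
    case True
    then show ?thesis
      using card_k_DIS_le_two_power[OF fin, of k] by simp
  next
    case False
    define deg where "deg w = card (neighbours G w)" for w
    obtain v where v: "v \<in> pverts G" and min: "\<And>w. w \<in> pverts G \<Longrightarrow> deg v \<le> deg w"
      using fin False
      by (metis arg_min_if_finite(1) arg_min_least)
    have Nsub: "neighbours G w \<subseteq> pverts G" for w
      using less.prems by (auto simp: neighbours_def pair_graph_iff)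
    have finN: "finite (neighbours G w)" for w
      using Nsub fin by (rule finite_subset)
    define n d where "n = card (pverts G)" and "d = deg v"
    \<comment> \<open>The value of the induction bound at n - d - 1 vertices. Deleting a closed
      neighbourhood leaves at most that many, because every degree is at least the minimum
      \<open>d\<close>.\<close>
    define E where "E = exp ((real n - real d - 1) / real k)"
    define A where "A u = {D. k_DIS k G D \<and> u \<in> D}" for u
    have finA: "finite (A u)" for u
      using finite_k_DIS[OF fin, of k] by (simp add: A_def)
    have A_le: "real (card (A u)) \<le> E" if u: "u \<in> pverts G" for u
    proof -
      let ?W = "pverts G - insert u (neighbours G u)"
      let ?H = "induced G ?W"
      have "u \<notin> neighbours G u"
        using less.prems by (auto simp: neighbours_def pair_graph_iff)
      then have card_closed: "card (insert u (neighbours G u)) = Suc (deg u)"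
        using finN by (simp add: deg_def)
      moreover have closed_sub: "insert u (neighbours G u) \<subseteq> pverts G"
        using Nsub u by auto
      ultimately have le: "Suc (deg u) \<le> n"
        using fin by (metis card_mono n_def)
      have cardW: "card ?W = n - Suc (deg u)"
        using closed_sub card_closed finN by (simp add: card_Diff_subset n_def)
      have H: "pair_graph ?H"
        by (rule pair_graph_induced[OF less.prems]) auto
      have pH: "pverts ?H = ?W"
        by (simp add: induced_def)
      have "card (A u) \<le> card {D. k_DIS k ?H D}"
      proof (rule card_inj_on_le)
        show "inj_on (\<lambda>D. D - {u}) (A u)"
          by (auto simp: inj_on_def A_def)
        show "(\<lambda>D. D - {u}) ` A u \<subseteq> {D. k_DIS k ?H D}"
          using k_DIS_delete_closed_neighbourhood[OF less.prems] by (auto simp: A_def)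
        show "finite {D. k_DIS k ?H D}"
          using H by (intro finite_k_DIS) (simp add: pair_graph_iff)
      qed
      also have "real (card {D. k_DIS k ?H D}) \<le> exp (real (card (pverts ?H)) / real k)"
        using cardW le by (intro less.hyps H) (simp add: pH n_def[symmetric])
      also have "real (card (pverts ?H)) = real n - real (deg u) - 1"
        using cardW le by (simp add: pH of_nat_diff)
      also have "exp ((real n - real (deg u) - 1) / real k) \<le> E"
        using min[OF u] assms(2) by (simp add: E_def d_def divide_right_mono)
      finally show ?thesis by simp
    qed
    define B where "B = {D. k_DIS k G D \<and> v \<notin> D}"
    have finB: "finite B"
      using finite_k_DIS[OF fin, of k] by (simp add: B_def)
    \<comment> \<open>Count the pairs of some \<open>D\<close> in \<open>B\<close> and a neighbour
      \<open>u\<close> of \<open>v\<close> in \<open>D\<close>: each \<open>D\<close> occurs at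
      least \<open>k\<close> times, each \<open>u\<close> at most \<open>card (A u)\<close>
      times.\<close>
    have "k * card B = (\<Sum>D\<in>B. k)" by simp
    also have "\<dots> \<le> (\<Sum>D\<in>B. card {u\<in>neighbours G v. u \<in> D})"
      using v by (intro sum_mono) (auto simp: B_def k_DIS_def Int_def)
    also have "\<dots> = (\<Sum>u\<in>neighbours G v. card {D\<in>B. u \<in> D})"
      using finB finN by (intro sum_multicount_gen) auto
    also have "\<dots> \<le> (\<Sum>u\<in>neighbours G v. card (A u))"
      using finA by (intro sum_mono card_mono) (auto simp: A_def B_def)
    finally have "real (k * card B) \<le> real (\<Sum>u\<in>neighbours G v. card (A u))"
      by (rule of_nat_mono)
    also have "\<dots> = (\<Sum>u\<in>neighbours G v. real (card (A u)))" by simp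
    also have "\<dots> \<le> (\<Sum>u\<in>neighbours G v. E)"
      using Nsub by (intro sum_mono A_le) auto
    finally have B_le: "real (card B) \<le> real d / real k * E"
      using assms(2) by (simp add: d_def deg_def field_simps)
    have "{D. k_DIS k G D} = A v \<union> B"
      by (auto simp: A_def B_def)
    then have "real (card {D. k_DIS k G D}) \<le> real (card (A v)) + real (card B)"
      using card_Un_le[of "A v" B] by simp
    also have "\<dots> \<le> (1 + real d / real k) * E"
      using A_le[OF v] B_le by (simp add: algebra_simps)
    also have "\<dots> \<le> exp (real d / real k) * E"
      using exp_ge_add_one_self[of "real d / real k"] by (simp add: E_def)
    \<comment> \<open>The exponents add up and the degree cancels.\<close>
    also have "\<dots> = exp ((real n - 1) / real k)"
      by (simp add: E_def exp_add[symmetric] add_divide_distrib[symmetric])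
    also have "\<dots> \<le> exp (real n / real k)"
      by (simp add: divide_right_mono)
    finally show ?thesis by (simp add: n_def)
  qed
qed

section \<open>The maximum number of k-DISes\<close>

lemma mi_set_finite:
  "finite {card {D. k_DIS k G D} | G :: nat pair_pre_digraph. pair_graph G \<and> card (pverts G) = n}"
proof (rule finite_subset)
  show "{card {D. k_DIS k G D} | G :: nat pair_pre_digraph. pair_graph G \<and> card (pverts G) = n}
      \<subseteq> {..2 ^ n}"
    using card_k_DIS_le_two_power by (auto simp: pair_graph_iff)
qed simp

text \<open>An injection of the finite vertex set into the naturals reduces any vertex type to the
  one in the definition of \<open>mi\<close>.\<close>

lemma card_k_DIS_le_mi:
  assumes G: "pair_graph G"
  shows "card {D. k_DIS k G D} \<le> mi k (card (pverts G))"
proof -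
  have "finite (pverts G)"
    using G by (simp add: pair_graph_iff)
  then obtain f :: "'a \<Rightarrow> nat" where f: "inj_on f (pverts G)"
    using finite_imp_inj_to_nat_seg by blast
  have "card (pverts (relabel f G)) = card (pverts G)"
    using f by (simp add: relabel_def card_image)
  then have "card {D. k_DIS k (relabel f G) D} \<le> mi k (card (pverts G))"
    unfolding mi_def using pair_graph_relabel[OF G f] by (intro Max_ge mi_set_finite) blast
  then show ?thesis
    using card_k_DIS_relabel[OF G f, of k] by linarith
qed

text \<open>A witness that the maximum defining \<open>mi\<close> is over a nonempty set. Its whole
  vertex set is a k-DIS, there being nothing left to dominate, so \<open>mi\<close> is positive and
  its logarithm nonnegative.\<close>

lemma edgeless:
  fixes n :: nat
  defines "G \<equiv> \<lparr>pverts = {..<n}, parcs = {}\<rparr>"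
  shows "pair_graph G" "card (pverts G) = n" "k_DIS k G {..<n}"
  by (auto simp: G_def pair_graph_iff sym_def k_DIS_def independent_set_def)

lemma mi_attained:
  obtains G :: "nat pair_pre_digraph"
  where "pair_graph G" "card (pverts G) = n" "mi k n = card {D. k_DIS k G D}"
proof -
  have "mi k n \<in> {card {D. k_DIS k G D} | G :: nat pair_pre_digraph.
      pair_graph G \<and> card (pverts G) = n}"
    unfolding mi_def using edgeless(1,2) by (intro Max_in mi_set_finite) blast
  then show thesis using that by blast
qed

lemma mi_pos: "0 < mi k n"
proof -
  let ?G = "\<lparr>pverts = {..<n}, parcs = {}\<rparr>"
  have "0 < card {D. k_DIS k ?G D}"
    using edgeless(3)[of k n] finite_k_DIS[of ?G k] by (auto simp: card_gt_0_iff)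
  then show ?thesis
    using card_k_DIS_le_mi[OF edgeless(1), of k n] by simp
qed

text \<open>Take the disjoint union of two extremal graphs.\<close>

lemma mi_supermult: "mi k m * mi k n \<le> mi k (m + n)"
proof -
  obtain G :: "nat pair_pre_digraph"
    where G: "pair_graph G" "card (pverts G) = m" "mi k m = card {D. k_DIS k G D}"
    by (rule mi_attained)
  obtain H :: "nat pair_pre_digraph"
    where H: "pair_graph H" "card (pverts H) = n" "mi k n = card {D. k_DIS k H D}"
    by (rule mi_attained)
  have "card (pverts (graph_sum G H)) = m + n"
    using G H by (simp add: graph_sum_def card_Plus pair_graph_iff)
  then show ?thesis
    using card_k_DIS_graph_sum[OF G(1) H(1), of k]
      card_k_DIS_le_mi[OF pair_graph_graph_sum[OF G(1) H(1)], of k] G H by simp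
qed

lemma mi_blowup:
  assumes "0 < m"
  shows "mi k n \<le> mi (k * m) (n * m)"
proof -
  obtain G :: "nat pair_pre_digraph"
    where G: "pair_graph G" "card (pverts G) = n" "mi k n = card {D. k_DIS k G D}"
    by (rule mi_attained)
  have "card (pverts (blowup m G)) = n * m"
    using G by (simp add: blowup_def card_cartesian_product)
  then show ?thesis
    using card_k_DIS_blowup[OF G(1) assms, of k]
      card_k_DIS_le_mi[OF pair_graph_blowup[OF G(1)], of "k * m" m] G by simp
qed

text \<open>Every l-DIS is a k-DIS, so an extremal graph for \<open>l\<close> has at least as many
  k-DISes.\<close>

lemma mi_antimono:
  assumes "k \<le> l"
  shows "mi l n \<le> mi k n"
proof -
  obtain G :: "nat pair_pre_digraph"
    where G: "pair_graph G" "card (pverts G) = n" "mi l n = card {D. k_DIS l G D}"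
    by (rule mi_attained)
  have "finite {D. k_DIS k G D}"
    using G by (intro finite_k_DIS) (simp add: pair_graph_iff)
  then have "mi l n \<le> card {D. k_DIS k G D}"
    unfolding G(3) by (intro card_mono) (auto simp: k_DIS_def intro: order.trans[OF assms])
  then show ?thesis
    using card_k_DIS_le_mi[OF G(1), of k] G by simp
qed

lemma mi_le_exp:
  assumes "0 < k"
  shows "real (mi k n) \<le> exp (real n / real k)"
proof -
  obtain G :: "nat pair_pre_digraph"
    where "pair_graph G" "card (pverts G) = n" "mi k n = card {D. k_DIS k G D}"
    by (rule mi_attained)
  then show ?thesis using card_k_DIS_le_exp[of G k] assms by simp
qed

lemma ln_mi_le:
  assumes "0 < k"
  shows "ln (real (mi k n)) \<le> real n / real k"
  using ln_mono[OF mi_le_exp[OF assms, of n]] mi_pos[of k n] by simp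

lemma fact_le_mi: "fact q \<le> mi 2 (q * q)"
  using card_k_DIS_rook_graph[of q] card_k_DIS_le_mi[OF pair_graph_rook_graph[of q], of 2]
  by (simp add: rook_graph_def card_cartesian_product)

section \<open>Limits\<close>

text \<open>For fixed \<open>n\<close> the lower bounds \<open>c n N * u n\<close> tend to
  \<open>u n\<close>, so the limit inferior of \<open>u\<close> is at least every \<open>u n\<close>
  with \<open>n\<close> positive, hence at least their supremum. It serves both for the existence of
  \<open>zeta\<close> and for the convergence of its powers.\<close>

lemma tendsto_of_almost_dominating:
  fixes u :: "nat \<Rightarrow> real" and c :: "nat \<Rightarrow> nat \<Rightarrow> real"
  assumes bdd: "\<And>n. 0 < n \<Longrightarrow> u n \<le> b"
    and le: "\<And>n N. 0 < n \<Longrightarrow> 0 < N \<Longrightarrow> c n N * u n \<le> u N"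
    and lim: "\<And>n. 0 < n \<Longrightarrow> c n \<longlonglongrightarrow> 1"
  obtains L where "u \<longlonglongrightarrow> L" "\<And>n. 0 < n \<Longrightarrow> u n \<le> L"
proof
  let ?L = "SUP n\<in>{0<..}. u n"
  have bd: "bdd_above (u ` {0<..})"
    using bdd by (auto intro!: bdd_aboveI2)
  show up: "u n \<le> ?L" if "0 < n" for n
    using that by (intro cSUP_upper bd) auto
  show "u \<longlonglongrightarrow> ?L"
  proof (rule order_tendstoI)
    fix a assume "a < ?L"
    then obtain n where n: "0 < n" "a < u n"
      using less_cSUP_iff[OF _ bd, of a] by auto
    have "(\<lambda>N. c n N * u n) \<longlonglongrightarrow> 1 * u n"
      by (intro tendsto_intros lim n)
    with n have "\<forall>\<^sub>F N in sequentially. a < c n N * u n"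
      by (auto dest: order_tendstoD(1))
    then show "\<forall>\<^sub>F N in sequentially. a < u N"
      using eventually_gt_at_top[of 0]
    proof eventually_elim
      case (elim N)
      with le[OF n(1), of N] show ?case by linarith
    qed
  next
    fix a assume "?L < a"
    show "\<forall>\<^sub>F N in sequentially. u N < a"
      using eventually_gt_at_top[of 0]
    proof eventually_elim
      case (elim N)
      with up[of N] \<open>?L < a\<close> show ?case by linarith
    qed
  qed
qed

text \<open>Write N = q * n + r with r < n. Then b N is at least q * b n, and q * n is at least N -
  n, which gives the weight (N - n) / N.\<close>

lemma fekete:
  fixes b :: "nat \<Rightarrow> real"
  assumes add: "\<And>m n. b m + b n \<le> b (m + n)"
    and nonneg: "\<And>n. 0 \<le> b n"
    and bdd: "\<And>n. b n \<le> C * real n"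
  obtains L where "(\<lambda>n. b n / real n) \<longlonglongrightarrow> L" "\<And>n. 0 < n \<Longrightarrow> b n / real n \<le> L"
\<comment> \<open>The subtraction is that of the reals: for N < n the weight is negative and the
  bound still holds.\<close>
proof (rule tendsto_of_almost_dominating[where u = "\<lambda>n. b n / real n" and b = C
      and c = "\<lambda>n N. (real N - real n) / real N"])
  show "b n / real n \<le> C" if "0 < n" for n
    using bdd[of n] that by (simp add: field_simps)
next
  fix n N :: nat assume nN: "0 < n" "0 < N"
  have mult: "real q * b n \<le> b (q * n)" for q
  proof (induction q)
    case 0
    then show ?case using nonneg by simp
  next
    case (Suc q)
    then show ?case using add[of n "q * n"] by (simp add: algebra_simps)
  qed
  have "real N - real n \<le> real (N div n) * real n"
  proof -
    have "N = N div n * n + N mod n" "N mod n < n" using nN by auto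
    then show ?thesis by (metis of_nat_add of_nat_mult of_nat_less_iff diff_le_eq add_left_mono less_imp_le)
  qed
  then have "(real N - real n) * (b n / real n) \<le> real (N div n) * real n * (b n / real n)"
    using nonneg[of n] by (intro mult_right_mono) auto
  also have "\<dots> = real (N div n) * b n"
    using nN by simp
  also have "\<dots> \<le> b (N div n * n)" by (rule mult)
  also have "\<dots> \<le> b (N div n * n + N mod n)"
    using add[of "N div n * n" "N mod n"] nonneg[of "N mod n"] by linarith
  also have "\<dots> = b N" by simp
  finally have "(real N - real n) * (b n / real n) / real N \<le> b N / real N"
    by (intro divide_right_mono) auto
  then show "(real N - real n) / real N * (b n / real n) \<le> b N / real N"
    by (simp add: mult.commute)
next
  show "(\<lambda>N. (real N - real n) / real N) \<longlonglongrightarrow> 1" for n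
    by real_asymp
qed (rule that)

section \<open>The growth rate \<open>zeta\<close> and its inequalities\<close>

lemma root_mi_eq:
  assumes "0 < n"
  shows "root n (real (mi k n)) = exp (ln (real (mi k n)) / real n)"
  using assms mi_pos[of k n] by (simp add: root_powr_inverse powr_def)

text \<open>Fekete's lemma applies to the logarithm of \<open>mi\<close>. Since the limit is also
  the supremum, the count in a single finite graph already bounds \<open>zeta\<close> from
  below.\<close>

lemma zeta_limit:
  assumes "0 < k"
  shows root_mi_tendsto_zeta: "(\<lambda>n. root n (real (mi k n))) \<longlonglongrightarrow> zeta k"
    and root_mi_le_zeta: "0 < n \<Longrightarrow> root n (real (mi k n)) \<le> zeta k"
proof -
  let ?b = "\<lambda>n. ln (real (mi k n))"
  have pos: "0 < real (mi k n)" for n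
    using mi_pos by simp
  obtain L where L: "(\<lambda>n. ?b n / real n) \<longlonglongrightarrow> L" "\<And>n. 0 < n \<Longrightarrow> ?b n / real n \<le> L"
  proof (rule fekete[of ?b "1 / real k"])
    show "?b m + ?b n \<le> ?b (m + n)" for m n
    proof -
      have "?b m + ?b n = ln (real (mi k m * mi k n))"
        using pos[of m] pos[of n] by (simp add: ln_mult_pos)
      also have "\<dots> \<le> ?b (m + n)"
        using mi_supermult[of k m n] mi_pos by (intro ln_mono) (simp_all flip: of_nat_mult)
      finally show ?thesis .
    qed
    show "0 \<le> ?b n" for n
      using mi_pos[of k n] by simp
    show "?b n \<le> 1 / real k * real n" for n
      using ln_mi_le[OF assms] by simp
  qed blast
  have "(\<lambda>n. exp (?b n / real n)) \<longlonglongrightarrow> exp L"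
    by (intro tendsto_intros L)
  \<comment> \<open>At n = 0 the two sides differ, as \<open>root 0\<close> is 0 but the exponential
    is 1.\<close>
  moreover have "\<forall>\<^sub>F n in sequentially. exp (?b n / real n) = root n (real (mi k n))"
    using eventually_gt_at_top[of 0] by eventually_elim (simp add: root_mi_eq)
  ultimately have lim: "(\<lambda>n. root n (real (mi k n))) \<longlonglongrightarrow> exp L"
    by (rule Lim_transform_eventually)
  then have "zeta k = exp L"
    unfolding zeta_def by (rule limI)
  then show "(\<lambda>n. root n (real (mi k n))) \<longlonglongrightarrow> zeta k"
    "0 < n \<Longrightarrow> root n (real (mi k n)) \<le> zeta k"
    using lim L(2) by (simp_all add: root_mi_eq)
qed

lemma zeta_ge_1:
  assumes "0 < k"
  shows "1 \<le> zeta k"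
  using root_mi_le_zeta[OF assms, of 1] mi_pos[of k 1] by simp

text \<open>The exponential bound on \<open>mi\<close> in the limit; it keeps
  \<open>k * ln (zeta k)\<close> below 1.\<close>

lemma zeta_le_exp:
  assumes "0 < k"
  shows "zeta k \<le> exp (1 / real k)"
proof (rule LIMSEQ_le_const2[OF root_mi_tendsto_zeta[OF assms]])
  have "root n (real (mi k n)) \<le> exp (1 / real k)" if "0 < n" for n
  proof -
    have "ln (real (mi k n)) \<le> real n / real k"
      by (rule ln_mi_le[OF assms])
    then have "ln (real (mi k n)) / real n \<le> 1 / real k"
      using that by (simp add: field_simps)
    then show ?thesis using that by (simp add: root_mi_eq)
  qed
  then show "\<exists>N. \<forall>n\<ge>N. root n (real (mi k n)) \<le> exp (1 / real k)"
    by (intro exI[of _ 1]) auto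
qed

lemma zeta_antimono:
  assumes "0 < k" "k \<le> l"
  shows "zeta l \<le> zeta k"
proof (rule LIMSEQ_le[OF root_mi_tendsto_zeta root_mi_tendsto_zeta])
  show "\<exists>N. \<forall>n\<ge>N. root n (real (mi l n)) \<le> root n (real (mi k n))"
    using mi_antimono[OF assms(2)] by (intro exI[of _ 1]) auto
qed (use assms in auto)

text \<open>Blowing up multiplies both \<open>k\<close> and the number of vertices by
  \<open>m\<close>, and an n-th root is the m-th power of an (n * m)-th root.\<close>

lemma zeta_le_zeta_mult_power:
  assumes "0 < k" "0 < m"
  shows "zeta k \<le> zeta (k * m) ^ m"
proof (rule LIMSEQ_le_const2[OF root_mi_tendsto_zeta[OF assms(1)]])
  have "root n (real (mi k n)) \<le> zeta (k * m) ^ m" if "0 < n" for n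
  proof -
    have "root n (real (mi k n)) \<le> root n (real (mi (k * m) (n * m)))"
      using that mi_blowup[OF assms(2)] by simp
    also have "\<dots> = root (n * m) (real (mi (k * m) (n * m))) ^ m"
      using that assms by (simp add: real_root_mult_exp mult.commute real_root_pow_pos2)
    also have "\<dots> \<le> zeta (k * m) ^ m"
      using that assms by (intro power_mono root_mi_le_zeta) auto
    finally show ?thesis .
  qed
  then show "\<exists>N. \<forall>n\<ge>N. root n (real (mi k n)) \<le> zeta (k * m) ^ m"
    by (intro exI[of _ 1]) auto
qed

section \<open>Convergence of the powers and the numerical bound\<close>

lemma zeta_power_tendsto:
  obtains L where "(\<lambda>k. zeta k ^ k) \<longlonglongrightarrow> L" "\<And>k. 0 < k \<Longrightarrow> zeta k ^ k \<le> L"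
proof -
  let ?g = "\<lambda>k. real k * ln (zeta k)"
  have pos: "0 < zeta k" if "0 < k" for k
    using zeta_ge_1[OF that] by linarith
  obtain L where L: "?g \<longlonglongrightarrow> L" "\<And>k. 0 < k \<Longrightarrow> ?g k \<le> L"
  proof (rule tendsto_of_almost_dominating[where u = ?g and b = 1
        and c = "\<lambda>k K. real K / (real K + real k)"])
    show "?g k \<le> 1" if "0 < k" for k
      using ln_mono[OF zeta_le_exp pos, of k] that by (simp add: field_simps)
  next
    fix k K :: nat assume kK: "0 < k" "0 < K"
    \<comment> \<open>With this choice \<open>k * m\<close> is the first multiple of
      \<open>k\<close> beyond \<open>K\<close>, overshooting by at most \<open>k\<close>.\<close>
    define m where "m = Suc (K div k)"
    have m: "K \<le> k * m" "k * m \<le> K + k"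
      using mult_div_mod_eq[of k K] mod_less_divisor[OF kK(1), of K]
      unfolding m_def mult_Suc_right by linarith+
    have "0 < m" by (simp add: m_def)
    have "zeta k \<le> zeta K ^ m"
    proof -
      have "zeta (k * m) ^ m \<le> zeta K ^ m"
        using zeta_antimono[OF kK(2) m(1)] pos[of "k * m"] kK \<open>0 < m\<close> by (intro power_mono) auto
      then show ?thesis
        using zeta_le_zeta_mult_power[OF kK(1) \<open>0 < m\<close>] by linarith
    qed
    then have "ln (zeta k) \<le> real m * ln (zeta K)"
      using pos kK by (simp flip: ln_realpow)
    then have "real k * ln (zeta k) \<le> real (k * m) * ln (zeta K)"
      using kK by (simp add: mult_left_mono)
    \<comment> \<open>Enlarging the factor is allowed because \<open>zeta K\<close> is at least 1,
      so its logarithm is nonnegative.\<close>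
    also have "\<dots> \<le> real (K + k) * ln (zeta K)"
      using m zeta_ge_1[OF kK(2)] by (intro mult_right_mono of_nat_mono) auto
    finally have "real K * ?g k \<le> real K * (real (K + k) * ln (zeta K))"
      by (intro mult_left_mono) auto
    then show "real K / (real K + real k) * ?g k \<le> ?g K"
      using kK by (simp add: field_simps)
  next
    show "(\<lambda>K. real K / (real K + real k)) \<longlonglongrightarrow> 1" for k
      by real_asymp
  qed blast
  have exp_g: "zeta k ^ k = exp (?g k)" if "0 < k" for k
    using pos[OF that] by (simp add: exp_of_nat_mult)
  have "(\<lambda>k. exp (?g k)) \<longlonglongrightarrow> exp L"
    by (intro tendsto_intros L)
  moreover have "\<forall>\<^sub>F k in sequentially. exp (?g k) = zeta k ^ k"
    using eventually_gt_at_top[of 0] by eventually_elim (simp add: exp_g)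
  ultimately have "(\<lambda>k. zeta k ^ k) \<longlonglongrightarrow> exp L"
    by (rule Lim_transform_eventually)
  then show thesis
    using L(2) by (intro that[of "exp L"]) (simp_all add: exp_g)
qed

lemma root_9_36_le_zeta_power:
  assumes "0 < k" "even k"
  shows "root 9 36 \<le> zeta k ^ k"
proof -
  obtain m where m: "k = 2 * m" "0 < m"
    using assms by (auto elim: evenE)
  \<comment> \<open>The 3! = 6 permutations on the 3 by 3 board with its 9 cells.\<close>
  have "real 6 \<le> real (mi 2 9)"
    using fact_le_mi[of 3] by (simp add: fact_numeral)
  then have "root 9 6 \<le> root 9 (real (mi 2 9))" by simp
  also have "\<dots> \<le> zeta 2"
    by (rule root_mi_le_zeta) auto
  also have "\<dots> \<le> zeta k ^ m"
    using zeta_le_zeta_mult_power[of 2 m] m by simp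
  \<comment> \<open>Squaring turns the exponent m = k / 2 into \<open>k\<close> and 6 into
    36.\<close>
  finally have "(root 9 6)\<^sup>2 \<le> (zeta k ^ m)\<^sup>2"
    by (intro power_mono) auto
  moreover have "(root 9 6)\<^sup>2 = root 9 (36 :: real)"
    by (simp flip: real_root_power)
  ultimately show ?thesis
    using m by (simp add: mult.commute flip: power_mult)
qed

theorem theorem1p7:
  shows "(\<forall>k::nat. 0 < k \<and> even k \<longrightarrow> root 9 36 \<le> zeta k ^ k) \<and>
         (\<exists>L::real. (\<lambda>k. zeta k ^ k) \<longlonglongrightarrow> L \<and> root 9 36 \<le> L)"
proof -
  obtain L where L: "(\<lambda>k. zeta k ^ k) \<longlonglongrightarrow> L" "\<And>k. 0 < k \<Longrightarrow> zeta k ^ k \<le> L"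
    using zeta_power_tendsto by blast
  \<comment> \<open>The limit dominates every term with positive index, so the term at k = 2
    suffices.\<close>
  have "root 9 36 \<le> L"
    using root_9_36_le_zeta_power[of 2] L(2)[of 2] by simp
  with L(1) root_9_36_le_zeta_power show ?thesis by blast
qed

end
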